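(* Let $n>2$. With the notation of the context, the following hold. (1) Any change from $\mathrm{SO}(n)$ maps $\mathcal{M}$ onto itself. (2) Scalar matrices are the only fixed points of the action of $\mathrm{SO}(n)$ by changes on $\mathrm{Sym}(n)$. (3) $\mathcal{M}$ is a union of mutually non-intersecting orbits. (4) Each matrix in $\mathcal{MD}$ is brought by some change from $\mathrm{SO}(n)$ to a diagonal-ordered matrix. In particular, each permutation of the diagonal of a matrix in $\mathcal{MD}$ is represented by some change from $\mathrm{SO}(n)$. (5) Two forms in $\mathcal{M}$ belong to the same orbit if and only if they have the same spectrum. (6) For each matrix in $\mathcal{M}$, its orbit contains exactly one diagonal-ordered matrix. (7.1) For each real number $t$ and each $A\in\mathrm{Sym}(n)$, $\mathrm{Orbit}(t\cdot A)=t\cdot\mathrm{Orbit}(A)$. (7.2) For $n=3$, the orbits of any two forms in $\mathcal{MH}$ are obtained from each other by some scalar shift and a homothety by some non-zero factor. (8.1) The discriminant of a real $n\times n$ matrix does not change under a scalar shift. Any scalar shift maps the surface $\mathcal{M}$ onto itself. (8.2) For each real number $s$, the intersection $\mathcal{M}_s$ of $\mathcal{M}$ with the hyperplane $\{X\in\mathrm{Sym}(n)\mid\mathrm{trace}(X)=s\}$ is a surface mapped onto itself by any change from $\mathrm{SO}(n)$. Moreover $\mathcal{M}$ is a straight cylinder over $\mathcal{M}_0$ having the line $\mathrm{Scal}$ as element.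
   Context: $\mathrm{Sym}(n)$ is the space of real symmetric $n\times n$ matrices (also called forms). The discriminant of a matrix is the discriminant of its characteristic polynomial, and $\mathcal{M}=\{X\in\mathrm{Sym}(n)\mid \mathrm{discr}(X)=0\}$ is the set of symmetric matrices with a multiple eigenvalue. $\mathcal{MH}$ is the set of matrices in $\mathrm{Sym}(n)$ with exactly $n-1$ different eigenvalues, and $\mathcal{MD}$ is the set of diagonal matrices in $\mathcal{M}$. The change by $g\in\mathrm{SO}(n)$ is the map $X\mapsto gXg^{*}$ ($g^{*}$ the transpose), and $\mathrm{Orbit}(A)=\{gAg^{*}\mid g\in\mathrm{SO}(n)\}$. The spectrum of a symmetric matrix is the multiset of its eigenvalues. A diagonal-ordered matrix is a diagonal matrix $D$ with $D_{1,1}\le\cdots\le D_{n,n}$. $E$ is the identity matrix, $\mathrm{Scal}=\{cE\mid c\in\mathbb{R}\}$; a scalar shift is a map $X\mapsto X+cE$, $c\in\mathbb{R}$, and a homothety by a factor $b$ is the map $X\mapsto bX$. "Straight cylinder over $\mathcal{M}_0$ having the line $\mathrm{Scal}$ as element" means that $\mathcal{M}_0$ lies in a hyperplane orthogonal to $\mathrm{Scal}$ (for the inner product $\langle X,Y\rangle=\sum_{i,j}x_{i,j}y_{i,j}$) and $\mathcal{M}=\{X+cE\mid X\in\mathcal{M}_0,\ c\in\mathbb{R}\}$. *)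

theory Defs
  imports
    "HOL-Combinatorics.Permutations"
    "Jordan_Normal_Form.Char_Poly"
    "Subresultants.Resultant_Prelim"
begin

definition Sym :: "nat \<Rightarrow> real mat set" where
  "Sym n = {X \<in> carrier_mat n n. transpose_mat X = X}"

(* The library predicate orthogonal_mat only asks for pairwise orthogonal nonzero columns,
   without normalization, so it is not used here. *)
definition SO :: "nat \<Rightarrow> real mat set" where
  "SO n = {g \<in> carrier_mat n n. g * transpose_mat g = 1\<^sub>m n \<and> det g = 1}"

definition change :: "real mat \<Rightarrow> real mat \<Rightarrow> real mat" where
  "change g X = g * X * transpose_mat g"

definition Orbit :: "nat \<Rightarrow> real mat \<Rightarrow> real mat set" where
  "Orbit n A = (\<lambda>g. change g A) ` SO n"

definition Orbits :: "nat \<Rightarrow> real mat set set" where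
  "Orbits n = Orbit n ` Sym n"

definition poly_discriminant :: "'a::field poly \<Rightarrow> 'a" where
  "poly_discriminant p =
     (-1) ^ (degree p * (degree p - 1) div 2) * resultant p (pderiv p) / lead_coeff p"

definition discr :: "real mat \<Rightarrow> real" where
  "discr X = poly_discriminant (char_poly X)"

definition M_set :: "nat \<Rightarrow> real mat set" where
  "M_set n = {X \<in> Sym n. discr X = 0}"

definition MH_set :: "nat \<Rightarrow> real mat set" where
  "MH_set n = {X \<in> Sym n. card {k. eigenvalue X k} = n - 1}"

definition MD_set :: "nat \<Rightarrow> real mat set" where
  "MD_set n = {X \<in> M_set n. diagonal_mat X}"

(* Eigenvalues counted with multiplicity as roots of the characteristic polynomial. *)
definition spectrum_mset :: "real mat \<Rightarrow> real multiset" where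
  "spectrum_mset X = proots (char_poly X)"

definition diagonal_ordered :: "nat \<Rightarrow> real mat \<Rightarrow> bool" where
  "diagonal_ordered n D \<longleftrightarrow> D \<in> carrier_mat n n \<and> diagonal_mat D \<and>
     (\<forall>i j. i \<le> j \<longrightarrow> j < n \<longrightarrow> D $$ (i, i) \<le> D $$ (j, j))"

definition permute_diagonal :: "nat \<Rightarrow> (nat \<Rightarrow> nat) \<Rightarrow> real mat \<Rightarrow> real mat" where
  "permute_diagonal n p D = mat n n (\<lambda>(i, j). if i = j then D $$ (p i, p i) else 0)"

definition Scal :: "nat \<Rightarrow> real mat set" where
  "Scal n = {c \<cdot>\<^sub>m 1\<^sub>m n | c. True}"

definition scalar_shift :: "nat \<Rightarrow> real \<Rightarrow> real mat \<Rightarrow> real mat" where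
  "scalar_shift n c X = X + c \<cdot>\<^sub>m 1\<^sub>m n"

definition homothety :: "real \<Rightarrow> real mat \<Rightarrow> real mat" where
  "homothety b X = b \<cdot>\<^sub>m X"

definition mat_inner :: "nat \<Rightarrow> real mat \<Rightarrow> real mat \<Rightarrow> real" where
  "mat_inner n X Y = (\<Sum>i<n. \<Sum>j<n. X $$ (i, j) * Y $$ (i, j))"

definition mat_trace :: "real mat \<Rightarrow> real" where
  "mat_trace X = (\<Sum>i<dim_row X. X $$ (i, i))"

definition trace_hyperplane :: "nat \<Rightarrow> real \<Rightarrow> real mat set" where
  "trace_hyperplane n s = {X \<in> Sym n. mat_trace X = s}"

definition M_slice :: "nat \<Rightarrow> real \<Rightarrow> real mat set" where
  "M_slice n s = M_set n \<inter> trace_hyperplane n s"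

definition is_hyperplane :: "nat \<Rightarrow> real mat set \<Rightarrow> bool" where
  "is_hyperplane n H \<longleftrightarrow>
     (\<exists>N \<in> Sym n. N \<noteq> 0\<^sub>m n n \<and> (\<exists>k. H = {X \<in> Sym n. mat_inner n N X = k}))"

definition orthogonal_to_Scal :: "nat \<Rightarrow> real mat set \<Rightarrow> bool" where
  "orthogonal_to_Scal n H \<longleftrightarrow>
     (\<forall>X \<in> H. \<forall>Y \<in> H. \<forall>Z \<in> Scal n. mat_inner n (X - Y) Z = 0)"

definition straight_cylinder_over :: "nat \<Rightarrow> real mat set \<Rightarrow> real mat set \<Rightarrow> bool" where
  "straight_cylinder_over n M M0 \<longleftrightarrow>
     (\<exists>H. is_hyperplane n H \<and> orthogonal_to_Scal n H \<and> M0 \<subseteq> H) \<and>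
     M = {X + c \<cdot>\<^sub>m 1\<^sub>m n | X c. X \<in> M0}"

inductive_set entry_polys :: "nat \<Rightarrow> (real mat \<Rightarrow> real) set" for n :: nat where
  const: "(\<lambda>X. c) \<in> entry_polys n"
| entry: "i < n \<Longrightarrow> j < n \<Longrightarrow> (\<lambda>X. X $$ (i, j)) \<in> entry_polys n"
| add: "f \<in> entry_polys n \<Longrightarrow> h \<in> entry_polys n \<Longrightarrow> (\<lambda>X. f X + h X) \<in> entry_polys n"
| mult: "f \<in> entry_polys n \<Longrightarrow> h \<in> entry_polys n \<Longrightarrow> (\<lambda>X. f X * h X) \<in> entry_polys n"

(* A surface in a space V of n x n matrices is a nonempty subset of V cut out by one polynomial
   equation in the matrix entries that is not an identity on V.  Over the reals its codimension
   may exceed 1: the equation discr = 0 has codimension 2 in the space of symmetric matrices. *)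
definition is_surface_in :: "nat \<Rightarrow> real mat set \<Rightarrow> real mat set \<Rightarrow> bool" where
  "is_surface_in n V S \<longleftrightarrow> S \<noteq> {} \<and>
     (\<exists>f \<in> entry_polys n. (\<exists>X \<in> V. f X \<noteq> 0) \<and> S = {X \<in> V. f X = 0})"

end

theory Submission
  imports Defs "Subresultants.Subresultant_Gcd" "HOL-Computational_Algebra.Field_as_Ring"
begin

text \<open>By the spectral theorem, proved with Householder reflections, every symmetric matrix is a change of
  a diagonal one, and a sign flip of one basis vector makes the change special orthogonal. Permutation
  matrices rearrange the diagonal, so the orbit of \<open>A\<close> contains exactly the diagonal matrices whose entries
  list the spectrum of \<open>A\<close>; this gives the statements about orbits, and for \<open>n = 3\<close> the affine map taking
  \<open>(a, a, b)\<close> to \<open>(a', a', b')\<close> compares two orbits with two distinct eigenvalues. The discriminant is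
  invariant under shifts because the resultant is computed by Euclid's algorithm, which commutes with
  the substitution of \<open>x + c\<close> for \<open>x\<close>. It is a polynomial in the entries of the matrix through the
  Sylvester determinant, and a diagonal matrix is a zero of it iff two of its entries agree.\<close>

section \<open>Orthogonal matrices and orbits\<close>

text \<open>The full orthogonal group is used because reflections and permutation matrices may have
  determinant -1: diagonalization is done here first, and the determinant is corrected
  afterwards.\<close>

definition orthogonal_matrices :: "nat \<Rightarrow> real mat set" where
  "orthogonal_matrices n = {g \<in> carrier_mat n n. g * transpose_mat g = 1\<^sub>m n}"

lemma orthogonal_matricesD:
  assumes "g \<in> orthogonal_matrices n"
  shows "g \<in> carrier_mat n n" "g * transpose_mat g = 1\<^sub>m n" "transpose_mat g * g = 1\<^sub>m n"
  using assms mat_mult_left_right_inverse[of g n "transpose_mat g"]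
  by (auto simp: orthogonal_matrices_def)

lemma SO_subset_orthogonal: "SO n \<subseteq> orthogonal_matrices n"
  by (auto simp: SO_def orthogonal_matrices_def)

lemma SO_carrier: "g \<in> SO n \<Longrightarrow> g \<in> carrier_mat n n"
  by (auto simp: SO_def)

lemma SymD: "X \<in> Sym n \<Longrightarrow> X \<in> carrier_mat n n" "X \<in> Sym n \<Longrightarrow> transpose_mat X = X"
  by (auto simp: Sym_def)

lemma change_carrier [simp]:
  "g \<in> carrier_mat n n \<Longrightarrow> X \<in> carrier_mat n n \<Longrightarrow> change g X \<in> carrier_mat n n"
  by (auto simp: change_def)

lemma change_change:
  assumes "g \<in> carrier_mat n n" "h \<in> carrier_mat n n" "X \<in> carrier_mat n n"
  shows "change g (change h X) = change (g * h) X"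
proof -
  have "change (g * h) X = g * h * X * (transpose_mat h * transpose_mat g)"
    using assms by (simp add: change_def transpose_mult[of g n n h n])
  also have "\<dots> = (g * h * X * transpose_mat h) * transpose_mat g"
    using assms by (intro assoc_mult_mat[symmetric, of _ n n _ n _ n]) auto
  also have "g * h * X * transpose_mat h = g * (h * X * transpose_mat h)"
    using assms by (simp add: assoc_mult_mat[of _ n n _ n _ n])
  finally show ?thesis by (simp add: change_def)
qed

lemma change_one: "X \<in> carrier_mat n n \<Longrightarrow> change (1\<^sub>m n) X = X"
  by (simp add: change_def)

lemma change_orthogonal_scalar:
  assumes "g \<in> orthogonal_matrices n"
  shows "change g (c \<cdot>\<^sub>m 1\<^sub>m n) = c \<cdot>\<^sub>m 1\<^sub>m n"
proof -
  note g = orthogonal_matricesD[OF assms]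
  have "g * (c \<cdot>\<^sub>m 1\<^sub>m n) = c \<cdot>\<^sub>m g"
    using g by (subst mult_smult_distrib[of _ n n _ n]) auto
  moreover have "(c \<cdot>\<^sub>m g) * transpose_mat g = c \<cdot>\<^sub>m (g * transpose_mat g)"
    using g by (intro mult_smult_assoc_mat[of _ n n _ n]) auto
  ultimately show ?thesis using g by (simp add: change_def)
qed

lemma change_add:
  assumes "g \<in> carrier_mat n n" "X \<in> carrier_mat n n" "Y \<in> carrier_mat n n"
  shows "change g (X + Y) = change g X + change g Y"
proof -
  have "g * (X + Y) = g * X + g * Y" using assms by (intro mult_add_distrib_mat) auto
  then show ?thesis unfolding change_def using assms
    by (simp add: add_mult_distrib_mat[of _ n n _ _ n])
qed

lemma change_smult:
  assumes "g \<in> carrier_mat n n" "X \<in> carrier_mat n n"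
  shows "change g (c \<cdot>\<^sub>m X) = c \<cdot>\<^sub>m change g X"
proof -
  have "g * (c \<cdot>\<^sub>m X) = c \<cdot>\<^sub>m (g * X)"
    using assms by (intro mult_smult_distrib[of _ n n _ n]) auto
  moreover have "(c \<cdot>\<^sub>m (g * X)) * transpose_mat g = c \<cdot>\<^sub>m (g * X * transpose_mat g)"
    using assms by (intro mult_smult_assoc_mat[of _ n n _ n]) auto
  ultimately show ?thesis by (simp add: change_def)
qed

lemma change_Sym:
  assumes "g \<in> carrier_mat n n" "X \<in> Sym n"
  shows "change g X \<in> Sym n"
proof -
  have X: "X \<in> carrier_mat n n" "transpose_mat X = X" using SymD assms by auto
  have "transpose_mat (g * X * transpose_mat g) = g * (X * transpose_mat g)"
    using X assms(1) by (simp add: transpose_mult[of "g * X" n n _ n] transpose_mult[of g n n X n]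
        del: assoc_mult_mat)
  also have "\<dots> = g * X * transpose_mat g"
    using X assms(1) by (intro assoc_mult_mat[symmetric, of _ n n _ n _ n]) auto
  finally show ?thesis using X assms(1) by (simp add: Sym_def change_def)
qed

lemma orthogonal_transpose:
  assumes "g \<in> orthogonal_matrices n"
  shows "transpose_mat g \<in> orthogonal_matrices n"
  using orthogonal_matricesD[OF assms] by (simp add: orthogonal_matrices_def)

lemma orthogonal_mult:
  assumes "g \<in> orthogonal_matrices n" "h \<in> orthogonal_matrices n"
  shows "g * h \<in> orthogonal_matrices n"
proof -
  note g = orthogonal_matricesD[OF assms(1)] and h = orthogonal_matricesD[OF assms(2)]
  \<comment> \<open>Reading the left side as the change of \<open>1\<^sub>m n\<close> by
    \<open>g * h\<close> lets the composition law for changes regroup the four factors.\<close>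
  have "(g * h) * transpose_mat (g * h) = change g (change h (1\<^sub>m n))"
    using g h by (simp add: change_change[of _ n] del: transpose_mult) (simp add: change_def)
  also have "\<dots> = 1\<^sub>m n" using g h by (simp add: change_def)
  finally show ?thesis using g h by (simp add: orthogonal_matrices_def)
qed

lemma SO_iff: "g \<in> SO n \<longleftrightarrow> g \<in> orthogonal_matrices n \<and> det g = 1"
  by (auto simp: SO_def orthogonal_matrices_def)

lemma SO_mult: "g \<in> SO n \<Longrightarrow> h \<in> SO n \<Longrightarrow> g * h \<in> SO n"
  using orthogonal_matricesD(1)[of g n] orthogonal_matricesD(1)[of h n]
  by (simp add: SO_iff orthogonal_mult det_mult[of g n h])

lemma SO_transpose: "g \<in> SO n \<Longrightarrow> transpose_mat g \<in> SO n"
  using orthogonal_matricesD(1)[of g n]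
  by (simp add: SO_iff orthogonal_transpose det_transpose[of g n])

lemma one_in_SO: "1\<^sub>m n \<in> SO n"
  by (simp add: SO_def)

lemma change_transpose_change:
  assumes "g \<in> orthogonal_matrices n" "X \<in> carrier_mat n n"
  shows "change (transpose_mat g) (change g X) = X" "change g (change (transpose_mat g) X) = X"
  using orthogonal_matricesD[OF assms(1)] assms(2) by (simp_all add: change_change[of _ n] change_one)

lemma Orbit_self: "X \<in> carrier_mat n n \<Longrightarrow> X \<in> Orbit n X"
  unfolding Orbit_def using one_in_SO change_one by (metis imageI)

text \<open>By closure of \<open>SO n\<close> under products, the orbit of a changed matrix lies
  inside the original orbit. The converse inclusion is the same fact for
  \<open>transpose_mat g\<close>, which carries \<open>Y\<close> back to \<open>X\<close>.\<close>

lemma Orbit_eq: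
  assumes X: "X \<in> carrier_mat n n" and Y: "Y \<in> Orbit n X"
  shows "Orbit n Y = Orbit n X"
proof -
  obtain g where g: "g \<in> SO n" and Yg: "Y = change g X" using Y by (auto simp: Orbit_def)
  note gc = SO_carrier[OF g] SO_carrier[OF SO_transpose[OF g]]
  have sub: "Orbit n (change k Z) \<subseteq> Orbit n Z" if "k \<in> SO n" "Z \<in> carrier_mat n n" for k Z
  proof
    fix W assume "W \<in> Orbit n (change k Z)"
    then obtain h where h: "h \<in> SO n" "W = change h (change k Z)" by (auto simp: Orbit_def)
    then have "W = change (h * k) Z" using that by (simp add: change_change[of _ n] SO_carrier)
    then show "W \<in> Orbit n Z" using SO_mult[OF h(1) that(1)] by (auto simp: Orbit_def)
  qed
  have "X = change (transpose_mat g) Y"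
    using change_transpose_change(1)[of g n X] g X Yg by (simp add: SO_iff)
  then show ?thesis using sub[OF g X] sub[OF SO_transpose[OF g], of Y] Yg X gc
    by (metis change_carrier subset_antisym)
qed

text \<open>The transpose of an orthogonal matrix is its inverse, so a change is a conjugation. This
  is why everything read off the characteristic polynomial is constant on orbits.\<close>

lemma similar_change:
  assumes "g \<in> orthogonal_matrices n" "X \<in> carrier_mat n n"
  shows "similar_mat (change g X) X"
proof (rule similar_matI)
  show "{change g X, X, g, transpose_mat g} \<subseteq> carrier_mat n n"
    using orthogonal_matricesD[OF assms(1)] assms(2) by simp
qed (use orthogonal_matricesD[OF assms(1)] in \<open>simp_all add: change_def\<close>)

lemma char_poly_change:
  "g \<in> orthogonal_matrices n \<Longrightarrow> X \<in> carrier_mat n n \<Longrightarrow> char_poly (change g X) = char_poly X"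
  by (intro char_poly_similar similar_change)

section \<open>The spectral theorem\<close>

text \<open>A complex eigenvector is split into its real and imaginary parts \<open>x\<close> and
  \<open>y\<close>. Symmetry forces the eigenvalue to be real, and then whichever of
  \<open>x\<close> and \<open>y\<close> is nonzero is a real eigenvector.\<close>

lemma symmetric_real_eigenvector:
  assumes A: "A \<in> Sym n" and n: "n > 0"
  obtains v k where "v \<in> carrier_vec n" "v \<noteq> 0\<^sub>v n" "A *\<^sub>v v = k \<cdot>\<^sub>v v"
proof -
  have Ac: "A \<in> carrier_mat n n" and At: "transpose_mat A = A" using SymD A by auto
  let ?C = "map_mat complex_of_real A"
  have Cc: "?C \<in> carrier_mat n n" using Ac by simp
  obtain as where as: "char_poly ?C = (\<Prod>a\<leftarrow>as. [:- a, 1:])" "length as = n"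
    using char_poly_factorized[OF Cc] by auto
  obtain k as' where "as = k # as'" using as(2) n by (cases as) auto
  then have "eigenvalue ?C k" using as by (simp add: eigenvalue_root_char_poly[OF Cc])
  then obtain w where "eigenvector ?C w k" unfolding eigenvalue_def by auto
  then have w: "w \<in> carrier_vec n" "w \<noteq> 0\<^sub>v n" "?C *\<^sub>v w = k \<cdot>\<^sub>v w"
    using Cc unfolding eigenvector_def by auto
  define x y where "x = map_vec Re w" and "y = map_vec Im w"
  have xy: "x \<in> carrier_vec n" "y \<in> carrier_vec n" using w unfolding x_def y_def by auto
  have row: "(\<Sum>j<n. complex_of_real (A $$ (i,j)) * w $ j) = k * w $ i" if "i < n" for i
  proof -
    have "(?C *\<^sub>v w) $ i = (k \<cdot>\<^sub>v w) $ i" using w(3) by simp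
    then show ?thesis using that w(1) Ac
      by (simp add: scalar_prod_def lessThan_atLeast0)
  qed
  have Ax: "A *\<^sub>v x = Re k \<cdot>\<^sub>v x - Im k \<cdot>\<^sub>v y"
  proof (rule eq_vecI)
    fix i assume "i < dim_vec (Re k \<cdot>\<^sub>v x - Im k \<cdot>\<^sub>v y)"
    then have i: "i < n" using xy by simp
    have "(\<Sum>j<n. A $$ (i,j) * Re (w $ j)) = Re (k * w $ i)"
      by (simp add: row[OF i, symmetric])
    then show "(A *\<^sub>v x) $ i = (Re k \<cdot>\<^sub>v x - Im k \<cdot>\<^sub>v y) $ i"
      using i Ac w(1) by (simp add: scalar_prod_def lessThan_atLeast0 x_def y_def)
  qed (use Ac xy in simp)
  have Ay: "A *\<^sub>v y = Re k \<cdot>\<^sub>v y + Im k \<cdot>\<^sub>v x"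
  proof (rule eq_vecI)
    fix i assume "i < dim_vec (Re k \<cdot>\<^sub>v y + Im k \<cdot>\<^sub>v x)"
    then have i: "i < n" using xy by simp
    have "(\<Sum>j<n. A $$ (i,j) * Im (w $ j)) = Im (k * w $ i)"
      by (simp add: row[OF i, symmetric])
    then show "(A *\<^sub>v y) $ i = (Re k \<cdot>\<^sub>v y + Im k \<cdot>\<^sub>v x) $ i"
      using i Ac w(1) by (simp add: scalar_prod_def lessThan_atLeast0 x_def y_def)
  qed (use Ac xy in simp)
  \<comment> \<open>Expanding both sides, the \<open>Re k\<close> terms cancel, and
    \<open>Im k\<close> remains as a factor of the sum of the two squared lengths, which is
    positive.\<close>
  have "x \<bullet> (A *\<^sub>v y) = (A *\<^sub>v x) \<bullet> y"
    using transpose_vec_mult_scalar[OF Ac xy(2,1)] At by simp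
  then have "Im k * (x \<bullet> x + y \<bullet> y) = 0"
    unfolding Ax Ay using xy
    by (simp add: scalar_prod_add_distrib[of _ n] minus_scalar_prod_distrib[of _ n] algebra_simps)
  moreover have nz: "x \<noteq> 0\<^sub>v n \<or> y \<noteq> 0\<^sub>v n"
  proof (rule ccontr)
    assume *: "\<not> ?thesis"
    have "w = 0\<^sub>v n"
    proof (rule eq_vecI)
      fix i assume i: "i < dim_vec (0\<^sub>v n)"
      have "x $ i = 0" "y $ i = 0" using * i by auto
      then show "w $ i = 0\<^sub>v n $ i" using i w(1) by (simp add: x_def y_def complex_eq_iff)
    qed (use w in simp)
    then show False using w by simp
  qed
  moreover have "x \<bullet> x + y \<bullet> y > 0"
    using nz conjugate_square_greater_0_vec[OF xy(1)] conjugate_square_greater_0_vec[OF xy(2)]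
      conjugate_square_ge_0_vec[of x] conjugate_square_ge_0_vec[of y] by auto
  ultimately have "Im k = 0" by simp
  then have "A *\<^sub>v x = Re k \<cdot>\<^sub>v x" "A *\<^sub>v y = Re k \<cdot>\<^sub>v y"
    unfolding Ax Ay using xy by auto
  then show ?thesis using that nz xy by auto
qed

text \<open>Moves a unit eigenvector to the first basis vector for the deflation in the spectral
  theorem. The case \<open>v = unit_vec n 0\<close> stands apart because the normal \<open>w\<close>
  of the mirror would vanish.\<close>

lemma orthogonal_to_first_unit_vec:
  fixes v :: "real vec"
  assumes v: "v \<in> carrier_vec n" and n: "n > 0" and unit: "v \<bullet> v = 1"
  obtains H where "H \<in> orthogonal_matrices n" "H *\<^sub>v v = unit_vec n 0"
proof (cases "v = unit_vec n 0")
  case True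
  then show ?thesis using that[of "1\<^sub>m n"] v by (simp add: orthogonal_matrices_def)
next
  case False
  \<comment> \<open>Householder reflection in the hyperplane orthogonal to \<open>v - e\<^sub>0\<close>.\<close>
  define w where "w = v - unit_vec n 0"
  define s where "s = w \<bullet> w"
  define H where "H = mat n n (\<lambda>(i,j). (if i = j then 1 else 0) - 2 / s * (w $ i * w $ j))"
  have w: "w \<in> carrier_vec n" using v by (simp add: w_def)
  have Hc: "H \<in> carrier_mat n n" by (simp add: H_def)
  \<comment> \<open>Unit length of \<open>v\<close> makes the scalar product of \<open>w\<close> and
    \<open>v\<close> equal to \<open>s / 2\<close>, exactly what the reflection needs to send
    \<open>v\<close> to \<open>v - w\<close>, the first basis vector.\<close>
  have s: "s = 2 - 2 * v $ 0" "w \<bullet> v = 1 - v $ 0"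
    unfolding s_def w_def using v n unit
    by (simp_all add: minus_scalar_prod_distrib[of _ n] scalar_prod_minus_distrib[of _ n])
  have "w \<noteq> 0\<^sub>v n"
  proof
    assume "w = 0\<^sub>v n"
    then have "w $ i = 0" if "i < n" for i using that by simp
    then have "v = unit_vec n 0" using v by (intro eq_vecI) (auto simp: w_def)
    then show False using False by simp
  qed
  then have s0: "s > 0" using conjugate_square_greater_0_vec[OF w] by (simp add: s_def)
  have s_sum: "s = (\<Sum>k<n. w $ k * w $ k)"
    using w by (simp add: s_def scalar_prod_def lessThan_atLeast0)
  have "H * transpose_mat H = 1\<^sub>m n"
  proof (rule eq_matI)
    fix i j assume "i < dim_row (1\<^sub>m n :: real mat)" "j < dim_col (1\<^sub>m n :: real mat)"
    then have ij: "i < n" "j < n" by auto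
    have "(H * transpose_mat H) $$ (i,j)
      = (\<Sum>k<n. ((if i = k then 1 else 0) - 2 / s * (w $ i * w $ k)) *
          ((if j = k then 1 else 0) - 2 / s * (w $ j * w $ k)))"
      using ij by (simp add: H_def scalar_prod_def lessThan_atLeast0)
    \<comment> \<open>The product expands into the identity part, two equal cross terms, and a
      quadratic term; summing the latter over \<open>k\<close> yields a factor \<open>s\<close>,
      after which it cancels both cross terms.\<close>
    also have "\<dots> = (\<Sum>k<n. (if k = i then (if j = i then 1 else 0) else 0)
        - (if k = j then 2 / s * (w $ i * w $ j) else 0)
        - (if k = i then 2 / s * (w $ j * w $ i) else 0)
        + 4 / s\<^sup>2 * (w $ i * w $ j) * (w $ k * w $ k))"
      by (intro sum.cong refl) (simp add: algebra_simps power2_eq_square)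
    also have "\<dots> = (if j = i then 1 else 0) - 4 / s * (w $ i * w $ j)
        + 4 / s\<^sup>2 * (w $ i * w $ j) * s"
      using ij by (simp add: sum.distrib sum_subtractf sum_divide_distrib[symmetric]
          sum_distrib_left[symmetric] s_sum[symmetric])
    also have "\<dots> = (if j = i then 1 else 0)"
      using s0 by (simp add: power2_eq_square)
    finally show "(H * transpose_mat H) $$ (i,j) = 1\<^sub>m n $$ (i,j)" using ij by simp
  qed (use Hc in auto)
  moreover have "H *\<^sub>v v = unit_vec n 0"
  proof (rule eq_vecI)
    fix i assume "i < dim_vec (unit_vec n 0 :: real vec)"
    then have i: "i < n" by simp
    have "(H *\<^sub>v v) $ i = (\<Sum>k<n. ((if i = k then 1 else 0) - 2 / s * (w $ i * w $ k)) * v $ k)"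
      using i v by (simp add: H_def scalar_prod_def lessThan_atLeast0)
    also have "\<dots> = (\<Sum>k<n. (if k = i then v $ i else 0) - 2 / s * w $ i * (w $ k * v $ k))"
      by (intro sum.cong refl) (simp add: algebra_simps)
    also have "\<dots> = v $ i - 2 / s * w $ i * (w \<bullet> v)"
      using i v by (simp add: sum_subtractf sum_divide_distrib[symmetric] sum_distrib_left[symmetric]
          scalar_prod_def lessThan_atLeast0)
    also have "2 / s * w $ i * (w \<bullet> v) = w $ i"
      using s0 s by (simp add: field_simps)
    finally show "(H *\<^sub>v v) $ i = unit_vec n 0 $ i" using i v by (simp add: w_def)
  qed (use Hc in simp)
  ultimately show ?thesis using that[of H] Hc by (simp add: orthogonal_matrices_def)
qed

text \<open>Deflation: once a unit eigenvector is rotated to the first basis vector, the matrix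
  splits into the eigenvalue and a smaller symmetric block, whose diagonalizing matrix is extended
  by a 1 in the corner.\<close>

lemma symmetric_orthogonally_diagonalizable:
  "A \<in> Sym n \<Longrightarrow> \<exists>g \<in> orthogonal_matrices n. \<exists>f. change g A = mat_diag n f"
proof (induction n arbitrary: A)
  case 0
  then have "A \<in> carrier_mat 0 0" by (rule SymD)
  then have "change (1\<^sub>m 0) A = mat_diag 0 (\<lambda>_. 0)"
    by (intro eq_matI) (auto simp: change_def mat_diag_def)
  then show ?case by (intro bexI exI) (auto simp: orthogonal_matrices_def)
next
  case (Suc n)
  have Ac: "A \<in> carrier_mat (Suc n) (Suc n)" using Suc.prems by (rule SymD)
  obtain v k where v: "v \<in> carrier_vec (Suc n)" "v \<noteq> 0\<^sub>v (Suc n)" and Av: "A *\<^sub>v v = k \<cdot>\<^sub>v v"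
    using symmetric_real_eigenvector[OF Suc.prems] by auto
  define u where "u = (1 / sqrt (v \<bullet> v)) \<cdot>\<^sub>v v"
  have "v \<bullet> v > 0" using v conjugate_square_greater_0_vec[OF v(1)] by simp
  then have unit: "u \<bullet> u = 1" using v by (simp add: u_def field_simps)
  have u: "u \<in> carrier_vec (Suc n)" using v by (simp add: u_def)
  have Au: "A *\<^sub>v u = k \<cdot>\<^sub>v u"
    using v Av Ac by (simp add: u_def mult_mat_vec smult_smult_assoc mult.commute)
  obtain H where H: "H \<in> orthogonal_matrices (Suc n)" and Hu: "H *\<^sub>v u = unit_vec (Suc n) 0"
    using orthogonal_to_first_unit_vec[OF u _ unit] by auto
  note Hm = orthogonal_matricesD[OF H]
  define B where "B = change H A"
  have B: "B \<in> Sym (Suc n)" unfolding B_def using change_Sym Hm Suc.prems by auto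
  have Bc: "B \<in> carrier_mat (Suc n) (Suc n)" using B by (rule SymD)
  have "transpose_mat H *\<^sub>v unit_vec (Suc n) 0 = u"
    using Hm u by (simp flip: Hu assoc_mult_mat_vec)
  moreover have "B *\<^sub>v unit_vec (Suc n) 0 = H *\<^sub>v (A *\<^sub>v (transpose_mat H *\<^sub>v unit_vec (Suc n) 0))"
    using Hm(1) Ac by (simp add: B_def change_def assoc_mult_mat_vec[of _ "Suc n" "Suc n" _ "Suc n"])
  ultimately have Be: "B *\<^sub>v unit_vec (Suc n) 0 = k \<cdot>\<^sub>v unit_vec (Suc n) 0"
    using Hm(1) u by (simp add: Au Hu mult_mat_vec)
  have B0: "B $$ (i, 0) = (if i = 0 then k else 0)" if "i < Suc n" for i
  proof -
    have "(B *\<^sub>v unit_vec (Suc n) 0) $ i = B $$ (i, 0)"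
      using that Bc by simp
    then show ?thesis using that by (simp add: Be split: if_splits)
  qed
  \<comment> \<open>The first column vanishes below the corner because the first basis vector is an
    eigenvector; symmetry carries this to the first row.\<close>
  have B0': "B $$ (0, i) = (if i = 0 then k else 0)" if "i < Suc n" for i
    using B0[OF that] SymD(2)[OF B] that Bc
    by (metis carrier_matD index_transpose_mat(1) zero_less_Suc)
  define C where "C = mat n n (\<lambda>(i,j). B $$ (Suc i, Suc j))"
  have "B $$ (Suc i, Suc j) = B $$ (Suc j, Suc i)" if "i < n" "j < n" for i j
    using that SymD(2)[OF B] Bc by (metis Suc_less_eq carrier_matD index_transpose_mat(1))
  then have C: "C \<in> Sym n" by (auto simp: C_def Sym_def intro!: eq_matI)
  have Cc: "C \<in> carrier_mat n n" using C by (rule SymD)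
  let ?k = "mat 1 1 (\<lambda>_. k) :: real mat"
  have Bblock: "B = four_block_mat ?k (0\<^sub>m 1 n) (0\<^sub>m n 1) C"
    using Bc B0 B0' by (intro eq_matI) (auto simp: C_def)
  obtain P f where P: "P \<in> orthogonal_matrices n" and f: "change P C = mat_diag n f"
    using Suc.IH[OF C] by auto
  note Pm = orthogonal_matricesD[OF P]
  define Q where "Q = four_block_mat (1\<^sub>m 1) (0\<^sub>m 1 n) (0\<^sub>m n 1) P"
  have Qc: "Q \<in> carrier_mat (Suc n) (Suc n)"
    using four_block_carrier_mat[of "1\<^sub>m 1" 1 1 P n n "0\<^sub>m 1 n" "0\<^sub>m n 1"] Pm(1) by (simp add: Q_def)
  have Qt: "transpose_mat Q = four_block_mat (1\<^sub>m 1) (0\<^sub>m 1 n) (0\<^sub>m n 1) (transpose_mat P)"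
    unfolding Q_def using Pm(1) by (subst transpose_four_block_mat[of _ 1 1 _ n _ n]) auto
  have mult: "four_block_mat D (0\<^sub>m 1 n) (0\<^sub>m n 1) R * four_block_mat D' (0\<^sub>m 1 n) (0\<^sub>m n 1) R'
     = four_block_mat (D * D') (0\<^sub>m 1 n) (0\<^sub>m n 1) (R * R')"
    if "D \<in> carrier_mat 1 1" "D' \<in> carrier_mat 1 1" "R \<in> carrier_mat n n" "R' \<in> carrier_mat n n"
    for D D' R R' :: "real mat"
    using that by (subst mult_four_block_mat[of _ 1 1 _ n _ n _ _ 1 _ n]) auto
  have "Q * transpose_mat Q = 1\<^sub>m (Suc n)"
    unfolding Qt unfolding Q_def using Pm by (subst mult) auto
  then have Q: "Q \<in> orthogonal_matrices (Suc n)" using Qc by (simp add: orthogonal_matrices_def)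
  have "change Q B = four_block_mat ?k (0\<^sub>m 1 n) (0\<^sub>m n 1) (change P C)"
    unfolding change_def Qt unfolding Q_def Bblock
    using Pm Cc by (subst mult; (subst mult)?; simp del: assoc_mult_mat)
  \<comment> \<open>\<open>case_nat k f\<close> puts \<open>k\<close> in front of the sequence
    \<open>f\<close>.\<close>
  also have "\<dots> = mat_diag (Suc n) (case_nat k f)"
    unfolding f by (intro eq_matI) (auto simp: mat_diag_def split: nat.split)
  finally have "change (Q * H) A = mat_diag (Suc n) (case_nat k f)"
    using change_change[OF Qc Hm(1) Ac] by (simp add: B_def)
  then show ?case using orthogonal_mult[OF Q H] by blast
qed

section \<open>Diagonal matrices in an orbit and the spectrum\<close>

lemma det_orthogonal:
  assumes "g \<in> orthogonal_matrices n"
  shows "det g * det g = 1"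
  using orthogonal_matricesD[OF assms] det_mult[of g n "transpose_mat g"] det_transpose[of g n]
  by simp

lemma change_mat_diag_mat_diag:
  "change (mat_diag n d) (mat_diag n f) = mat_diag n (\<lambda>i. d i * f i * d i)"
proof -
  have "transpose_mat (mat_diag n d) = mat_diag n d"
    by (intro eq_matI) (auto simp: mat_diag_def)
  then show ?thesis by (simp add: change_def)
qed

text \<open>A change of sign of the first basis vector fixes diagonal matrices, which makes up for the
  determinant.\<close>

lemma mat_diag_in_Orbit:
  assumes g: "g \<in> orthogonal_matrices n" and X: "X \<in> carrier_mat n n" and n: "n > 0"
    and diag: "change g X = mat_diag n f"
  shows "mat_diag n f \<in> Orbit n X"
proof -
  note gm = orthogonal_matricesD[OF g] and dd = det_orthogonal[OF g]
  \<comment> \<open>The first sign is \<open>det g\<close> itself, so the product has determinant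
    \<open>det g * det g = 1\<close> without a case distinction; for \<open>det g = 1\<close> the
    correcting matrix is the identity.\<close>
  define d where "d i = (if i = 0 then det g else 1)" for i :: nat
  let ?s = "mat_diag n d"
  have dd1: "d i * d i = 1" for i using dd by (simp add: d_def)
  have s: "?s \<in> orthogonal_matrices n"
  proof -
    have "transpose_mat ?s = ?s" by (intro eq_matI) (auto simp: mat_diag_def)
    then show ?thesis by (simp add: orthogonal_matrices_def dd1)
  qed
  have "det ?s = prod_list (diag_mat ?s)"
    by (rule det_upper_triangular[of _ n]) (auto simp: upper_triangular_def mat_diag_def)
  also have "\<dots> = (\<Prod>i = 0..<n. d i)"
    unfolding prod_list_diag_prod by (simp add: mat_diag_def)
  also have "\<dots> = det g" unfolding d_def using n by simp
  finally have "det (?s * g) = 1" using gm dd by (simp add: det_mult[of _ n])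
  then have "?s * g \<in> SO n" using orthogonal_mult[OF s g] by (simp add: SO_iff)
  moreover have "change (?s * g) X = mat_diag n f"
  proof -
    have "(\<lambda>i. d i * f i * d i) = f"
      using dd1 by (intro ext) (metis mult.assoc mult.commute mult_1_right)
    moreover have "change (?s * g) X = change ?s (change g X)"
      using gm X by (simp add: change_change[of _ n])
    ultimately show ?thesis by (simp add: diag change_mat_diag_mat_diag)
  qed
  ultimately show ?thesis unfolding Orbit_def by (metis imageI)
qed

text \<open>Row \<open>i\<close> of the permutation matrix \<open>P\<close> is the unit vector at
  \<open>p i\<close>, so the change by \<open>P\<close> moves entry \<open>p i\<close> to place
  \<open>i\<close>. For odd \<open>p\<close> the determinant of \<open>P\<close> is -1, which
  \<open>mat_diag_in_Orbit\<close> repairs.\<close>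

lemma permuted_mat_diag_in_Orbit:
  assumes p: "p permutes {..<n}" and n: "n > 0"
  shows "mat_diag n (f \<circ> p) \<in> Orbit n (mat_diag n f)"
proof -
  define P where "P = mat n n (\<lambda>(i,j). if j = p i then 1 else 0 :: real)"
  have pn: "p i < n" if "i < n" for i using p that permutes_in_image by fastforce
  have inj: "p i = p j \<longleftrightarrow> i = j" for i j using permutes_inj[OF p] by (auto dest: injD)
  have "P * transpose_mat P = 1\<^sub>m n"
  proof (rule eq_matI)
    fix i j assume "i < dim_row (1\<^sub>m n :: real mat)" "j < dim_col (1\<^sub>m n :: real mat)"
    then have ij: "i < n" "j < n" by auto
    have "(P * transpose_mat P) $$ (i,j)
      = (\<Sum>k = 0..<n. (if k = p i then 1 else 0) * (if k = p j then 1 else 0))"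
      using ij by (simp add: P_def scalar_prod_def)
    also have "\<dots> = (\<Sum>k = 0..<n. if k = p i then (if p i = p j then 1 else 0) else 0)"
      by (intro sum.cong) auto
    also have "\<dots> = 1\<^sub>m n $$ (i,j)" using ij pn inj by simp
    finally show "(P * transpose_mat P) $$ (i,j) = 1\<^sub>m n $$ (i,j)" .
  qed (auto simp: P_def)
  then have P: "P \<in> orthogonal_matrices n" by (simp add: orthogonal_matrices_def P_def)
  have "change P (mat_diag n f) = mat_diag n (f \<circ> p)"
  proof (rule eq_matI)
    fix i j assume "i < dim_row (mat_diag n (f \<circ> p))" "j < dim_col (mat_diag n (f \<circ> p))"
    then have ij: "i < n" "j < n" by (auto simp: mat_diag_def)
    have "P * mat_diag n f = mat n n (\<lambda>(i,j). P $$ (i,j) * f j)"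
      by (rule mat_diag_mult_right) (simp add: P_def)
    then have "change P (mat_diag n f) $$ (i,j)
      = (\<Sum>k = 0..<n. (if k = p i then 1 else 0) * f k * (if k = p j then 1 else 0))"
      using ij by (simp add: change_def P_def scalar_prod_def)
    also have "\<dots> = (\<Sum>k = 0..<n. if k = p i then (if p i = p j then f (p i) else 0) else 0)"
      by (intro sum.cong) auto
    also have "\<dots> = mat_diag n (f \<circ> p) $$ (i,j)" using ij pn inj by (simp add: mat_diag_def)
    finally show "change P (mat_diag n f) $$ (i,j) = mat_diag n (f \<circ> p) $$ (i,j)" .
  qed (auto simp: P_def change_def mat_diag_def)
  then show ?thesis by (intro mat_diag_in_Orbit[OF P _ n]) auto
qed

lemma spectrum_mset_mat_diag: "spectrum_mset (mat_diag n f) = mset (map f [0..<n])"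
proof -
  have ut: "upper_triangular (mat_diag n f)" by (simp add: upper_triangular_def mat_diag_def)
  have "diag_mat (mat_diag n f) = map f [0..<n]"
    by (intro nth_equalityI) (auto simp: diag_mat_def mat_diag_def)
  then have "char_poly (mat_diag n f) = (\<Prod>a\<leftarrow>map f [0..<n]. [:- a, 1:])"
    using char_poly_upper_triangular[OF mat_diag_dim ut] by simp
  moreover have "proots (\<Prod>a\<leftarrow>xs. [:- a, 1:]) = mset xs" for xs :: "real list"
  proof (induction xs)
    case (Cons a xs)
    have "(\<Prod>a\<leftarrow>xs. [:- a, 1:]) \<noteq> 0" by (auto simp: prod_list_zero_iff)
    then show ?case using Cons proots_linear_factor[of "- a"]
      by (simp add: proots_mult del: mult_pCons_left)
  qed simp
  ultimately show ?thesis by (simp only: spectrum_mset_def)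
qed

lemma spectrum_mset_Orbit:
  assumes "X \<in> carrier_mat n n" "Y \<in> Orbit n X"
  shows "spectrum_mset Y = spectrum_mset X"
  using assms by (auto simp: Orbit_def spectrum_mset_def SO_iff char_poly_change)

text \<open>The tool behind the classification of orbits. The spectral theorem puts some diagonal
  matrix into the orbit; a second one with the same multiset of entries is a permutation of it,
  hence in the orbit too.\<close>

lemma mat_diag_in_Orbit_iff:
  assumes A: "A \<in> Sym n" and n: "n > 0"
  shows "mat_diag n f \<in> Orbit n A \<longleftrightarrow> spectrum_mset A = mset (map f [0..<n])"
proof
  assume "mat_diag n f \<in> Orbit n A"
  then show "spectrum_mset A = mset (map f [0..<n])"
    using spectrum_mset_Orbit SymD(1)[OF A] spectrum_mset_mat_diag by metis
next
  assume spec: "spectrum_mset A = mset (map f [0..<n])"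
  have Ac: "A \<in> carrier_mat n n" using A by (rule SymD)
  obtain g h where "g \<in> orthogonal_matrices n" "change g A = mat_diag n h"
    using symmetric_orthogonally_diagonalizable[OF A] by auto
  then have h: "mat_diag n h \<in> Orbit n A" using mat_diag_in_Orbit Ac n by blast
  then have "mset (map f [0..<n]) = mset (map h [0..<n])"
    using spec spectrum_mset_Orbit[OF Ac h] by (simp add: spectrum_mset_mat_diag del: mset_map)
  then obtain p where p: "p permutes {..<n}" and "permute_list p (map h [0..<n]) = map f [0..<n]"
    by (elim mset_eq_permutation) simp
  then have "map f [0..<n] ! i = permute_list p (map h [0..<n]) ! i" for i by simp
  moreover have "p i < n" if "i < n" for i using p that permutes_in_image by fastforce
  ultimately have "f i = h (p i)" if "i < n" for i
    using that p permute_list_nth[of p "map h [0..<n]" i] by (metis add_0 diff_zero length_map length_upt nth_map nth_upt)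
  then have "mat_diag n f = mat_diag n (h \<circ> p)" by (intro eq_matI) (auto simp: mat_diag_def)
  then show "mat_diag n f \<in> Orbit n A"
    using permuted_mat_diag_in_Orbit[OF p n, of h] Orbit_eq[OF Ac h] by simp
qed

section \<open>The discriminant\<close>

lemma pcompose_linear_lead_coeff:
  "lead_coeff (pcompose p [:c, 1:]) = lead_coeff (p :: 'a :: field poly)"
  by (subst lead_coeff_comp) auto

text \<open>Both sides obey the recursion of Euclid's algorithm, which commutes with the substitution.\<close>

lemma resultant_pcompose_linear:
  fixes F G :: "'a :: field poly"
  shows "resultant (pcompose F [:c, 1:]) (pcompose G [:c, 1:]) = resultant F G"
proof -
  have main: "resultant (pcompose F [:c, 1:]) (pcompose G [:c, 1:]) = resultant F G"
    if "degree G \<le> degree F" for F G :: "'a poly"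
    using that
  proof (induction "degree G" arbitrary: F G rule: less_induct)
    case less
    show ?case
    proof (cases "degree G = 0")
      case True
      then obtain a where "G = [:a:]" by (rule degree_eq_zeroE)
      then show ?thesis by (simp add: pcompose_const)
    next
      case False
      \<comment> \<open>The sign brings division with remainder into the additive form that the
        subresultant lemmas expect. Substituting into this equation gives the corresponding one for
        the shifted polynomials directly.\<close>
      define B H where "B = - (F div G)" and "H = F mod G"
      have eq: "F + B * G = H" unfolding B_def H_def by (simp add: minus_div_mult_eq_mod)
      let ?S = "\<lambda>p. pcompose p [:c, 1:]"
      have "?S (F + B * G) = ?S H" by (simp add: eq)
      then have eqS: "?S F + ?S B * ?S G = ?S H" by (simp add: pcompose_add pcompose_mult)
      have H: "degree H < degree G" using False degree_mod_less'[of G F]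
        by (cases "H = 0"; cases "G = 0") (auto simp: H_def)
      show ?thesis
      proof (cases "degree H = 0")
        \<comment> \<open>The recursion ends at a constant remainder, possibly zero. The closed
          formula involves only degrees, leading coefficients and \<open>h\<close>, all kept by the
          substitution.\<close>
        case True
        then obtain h where h: "H = [:h:]" by (rule degree_eq_zeroE)
        have "resultant F G = (-1) ^ (degree F * degree G) * lead_coeff G ^ degree F
          * lead_coeff H ^ (degree G - 1) * h"
          using BT_lemma_1_13[OF eq less.prems] H True
          unfolding coeff_subresultant_0_0_resultant[symmetric] by (simp add: h)
        moreover have "resultant (?S F) (?S G) = (-1) ^ (degree F * degree G) * lead_coeff G ^ degree F
          * lead_coeff H ^ (degree G - 1) * h"
          using BT_lemma_1_13[OF eqS] less.prems H True pcompose_linear_lead_coeff[of G c]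
          unfolding coeff_subresultant_0_0_resultant[symmetric] by (simp add: h pcompose_const)
        ultimately show ?thesis by simp
      next
        case dH: False
        \<comment> \<open>The instance at index 0 concerns the resultant, seen as the constant
          coefficient of the subresultant of index 0.\<close>
        have "resultant F G = (-1) ^ (degree F * degree G) * lead_coeff G ^ (degree F - degree H)
          * resultant G H"
          using BT_lemma_1_12[OF eq less.prems, of 0] H dH
          unfolding coeff_subresultant_0_0_resultant[symmetric] by simp
        moreover have "resultant (?S F) (?S G) =
          (-1) ^ (degree F * degree G) * lead_coeff G ^ (degree F - degree H) * resultant (?S G) (?S H)"
          using BT_lemma_1_12[OF eqS, of 0] less.prems H dH pcompose_linear_lead_coeff[of G c]
          unfolding coeff_subresultant_0_0_resultant[symmetric] by simp
        ultimately show ?thesis using less.hyps[OF H] H by simp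
      qed
    qed
  qed
  show ?thesis
  proof (cases "degree G \<le> degree F")
    \<comment> \<open>Swapping the arguments costs a sign that depends only on the degrees, so it is
      the same on both sides.\<close>
    case False
    then have "resultant (pcompose G [:c, 1:]) (pcompose F [:c, 1:]) = resultant G F"
      by (intro main) simp
    then show ?thesis
      by (subst resultant_swap, subst (2) resultant_swap) simp
  qed (rule main)
qed

text \<open>The inner polynomial has derivative 1, so the substitution commutes with
  \<open>pderiv\<close>; degree and leading coefficient are kept as well.\<close>

lemma poly_discriminant_pcompose_linear:
  "poly_discriminant (pcompose p [:c, 1:]) = poly_discriminant (p :: 'a :: field poly)"
proof -
  have "pderiv (pcompose p [:c, 1:]) = pcompose (pderiv p) [:c, 1:]"
    by (simp add: pderiv_pcompose pderiv_pCons)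
  then show ?thesis
    unfolding poly_discriminant_def pcompose_linear_lead_coeff
    by (simp only: resultant_pcompose_linear) simp
qed

text \<open>Shifting the matrix by \<open>c\<close> and evaluating at \<open>k\<close> is evaluating
  at \<open>k - c\<close>. Agreement at all real points suffices for equality of the
  polynomials.\<close>

lemma char_poly_scalar_shift:
  assumes A: "A \<in> carrier_mat n n"
  shows "char_poly (scalar_shift n c A) = pcompose (char_poly A) [:- c, 1:]"
proof -
  have S: "scalar_shift n c A \<in> carrier_mat n n" using A by (simp add: scalar_shift_def)
  have "poly (char_poly (scalar_shift n c A)) k = poly (char_poly A) (k - c)" for k
  proof -
    have "char_matrix (scalar_shift n c A) k = char_matrix A (k - c)"
      using A by (intro eq_matI) (auto simp: char_matrix_def scalar_shift_def)
    then show ?thesis by (simp add: char_poly_matrix[OF S] char_poly_matrix[OF A])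
  qed
  then have "poly (char_poly (scalar_shift n c A)) = poly (pcompose (char_poly A) [:- c, 1:])"
    by (intro ext) (simp add: poly_pcompose)
  then show ?thesis by (simp add: poly_eq_poly_eq_iff)
qed

lemma discr_scalar_shift:
  "A \<in> carrier_mat n n \<Longrightarrow> discr (scalar_shift n c A) = discr A"
  by (simp only: discr_def char_poly_scalar_shift poly_discriminant_pcompose_linear)

text \<open>A zero resultant means a nonconstant gcd of \<open>p\<close> and its derivative. Turning
  this into a common real root requires splitting over the reals: the square of
  \<open>x^2 + 1\<close> has discriminant zero, yet no real root at all.\<close>

lemma poly_discriminant_eq_0_iff:
  fixes p :: "real poly"
  assumes p: "p \<noteq> 0" and split: "size (proots p) = degree p"
  shows "poly_discriminant p = 0 \<longleftrightarrow> \<not> rsquarefree p"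
proof -
  let ?g = "gcd p (pderiv p)"
  have g: "?g \<noteq> 0" using p by simp
  obtain h where h: "p = ?g * h" using gcd_dvd1 by (rule dvdE)
  then have h0: "h \<noteq> 0" using p by auto
  \<comment> \<open>Root counts and degrees both add up along \<open>p = ?g * h\<close>. Since
    neither factor has more roots than its degree, equality for \<open>p\<close> forces equality for
    \<open>?g\<close>.\<close>
  have "size (proots ?g) + size (proots h) = degree ?g + degree h"
    using h g h0 split by (metis proots_mult size_union degree_mult_eq)
  then have roots: "size (proots ?g) = degree ?g"
    using size_proots_le[of ?g] size_proots_le[of h] by simp
  have "poly_discriminant p = 0 \<longleftrightarrow> degree ?g \<noteq> 0"
    using p by (simp add: poly_discriminant_def resultant_0_gcd)
  also have "\<dots> \<longleftrightarrow> (\<exists>a. a \<in># proots ?g)"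
    unfolding roots[symmetric] by (metis multiset_nonemptyE size_eq_0_iff_empty not_in_iff count_empty)
  also have "\<dots> \<longleftrightarrow> (\<exists>a. poly p a = 0 \<and> poly (pderiv p) a = 0)"
    using g by (simp add: poly_eq_0_iff_dvd)
  also have "\<dots> \<longleftrightarrow> \<not> rsquarefree p" by (simp add: rsquarefree_roots)
  finally show ?thesis .
qed

section \<open>Polynomials in the matrix entries\<close>

lemma sum_closed:
  fixes S :: "('x \<Rightarrow> 'a :: comm_ring_1) set"
  assumes const: "\<And>c. (\<lambda>_. c) \<in> S"
    and add: "\<And>f h. f \<in> S \<Longrightarrow> h \<in> S \<Longrightarrow> (\<lambda>x. f x + h x) \<in> S"
    and f: "\<And>i. i \<in> I \<Longrightarrow> f i \<in> S"
  shows "(\<lambda>x. \<Sum>i\<in>I. f i x) \<in> S"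
  using f by (induction I rule: infinite_finite_induct) (auto simp: const intro!: add)

lemma prod_closed:
  fixes S :: "('x \<Rightarrow> 'a :: comm_ring_1) set"
  assumes const: "\<And>c. (\<lambda>_. c) \<in> S"
    and mult: "\<And>f h. f \<in> S \<Longrightarrow> h \<in> S \<Longrightarrow> (\<lambda>x. f x * h x) \<in> S"
    and f: "\<And>i. i \<in> I \<Longrightarrow> f i \<in> S"
  shows "(\<lambda>x. \<Prod>i\<in>I. f i x) \<in> S"
  using f by (induction I rule: infinite_finite_induct) (auto simp: const intro!: mult)

text \<open>Leibniz formula. \<open>S\<close> is kept abstract because it is instantiated twice:
  with \<open>entry_polys n\<close>, and with polynomial-valued functions all of whose coefficients
  lie in \<open>entry_polys n\<close>.\<close>

lemma det_closed:
  fixes S :: "('x \<Rightarrow> 'a :: comm_ring_1) set"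
  assumes const: "\<And>c. (\<lambda>_. c) \<in> S"
    and add: "\<And>f h. f \<in> S \<Longrightarrow> h \<in> S \<Longrightarrow> (\<lambda>x. f x + h x) \<in> S"
    and mult: "\<And>f h. f \<in> S \<Longrightarrow> h \<in> S \<Longrightarrow> (\<lambda>x. f x * h x) \<in> S"
    and M: "\<And>i j. i < m \<Longrightarrow> j < m \<Longrightarrow> (\<lambda>x. M x i j) \<in> S"
  shows "(\<lambda>x. det (mat m m (\<lambda>(i,j). M x i j))) \<in> S"
proof -
  have "det (mat m m (\<lambda>(i,j). M x i j))
    = (\<Sum>p\<in>{p. p permutes {0..<m}}. signof p * (\<Prod>i = 0..<m. M x i (p i)))" for x
    by (subst det_def'[of _ m]) (auto intro!: sum.cong prod.cong simp: permutes_in_image)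
  moreover have "(\<lambda>x. \<Sum>p\<in>{p. p permutes {0..<m}}. signof p * (\<Prod>i = 0..<m. M x i (p i))) \<in> S"
    by (intro sum_closed prod_closed mult const add M) (auto simp: permutes_in_image)
  ultimately show ?thesis by simp
qed

lemma entry_polys_det:
  assumes "\<And>i j. i < m \<Longrightarrow> j < m \<Longrightarrow> (\<lambda>X. M X i j) \<in> entry_polys n"
  shows "(\<lambda>X. det (mat m m (\<lambda>(i,j). M X i j))) \<in> entry_polys n"
  by (intro det_closed entry_polys.intros assms)

lemma entry_polys_coeff_det:
  assumes "\<And>i j k. i < m \<Longrightarrow> j < m \<Longrightarrow> (\<lambda>X. coeff (M X i j) k) \<in> entry_polys n"
  shows "(\<lambda>X. coeff (det (mat m m (\<lambda>(i,j). M X i j))) k) \<in> entry_polys n"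
proof -
  let ?S = "{F. \<forall>k. (\<lambda>X. coeff (F X) k) \<in> entry_polys n}"
  have "(\<lambda>X. det (mat m m (\<lambda>(i,j). M X i j))) \<in> ?S"
  proof (rule det_closed)
    fix F G assume "F \<in> ?S" "G \<in> ?S"
    then show "(\<lambda>X. F X * G X) \<in> ?S"
      by (auto simp: coeff_mult intro!: sum_closed entry_polys.intros)
  qed (use assms in \<open>auto intro: entry_polys.intros\<close>)
  then show ?thesis by simp
qed

text \<open>The characteristic polynomial is a determinant, so its coefficients are polynomials in
  the entries; the resultant is the determinant of a Sylvester matrix of these coefficients.\<close>

lemma discr_entry_poly:
  assumes n: "n > 0"
  obtains f where "f \<in> entry_polys n" "\<And>X. X \<in> carrier_mat n n \<Longrightarrow> f X = discr X"
proof -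
  define C :: "real mat \<Rightarrow> real poly" where
    "C X = det (mat n n (\<lambda>(i,j). [:- X $$ (i,j), if i = j then 1 else 0:]))" for X
  have C: "C X = char_poly X" if "X \<in> carrier_mat n n" for X
  proof -
    have "char_poly_matrix X = mat n n (\<lambda>(i,j). [:- X $$ (i,j), if i = j then 1 else 0:])"
      using that by (intro eq_matI) (auto simp: char_poly_matrix_def)
    then show ?thesis by (simp add: C_def char_poly_def)
  qed
  have neg: "(\<lambda>X. - X $$ (i,j)) \<in> entry_polys n" if "i < n" "j < n" for i j
    using entry_polys.mult[OF entry_polys.const[of "-1"] entry_polys.entry[OF that]] by simp
  have coeffC: "(\<lambda>X. coeff (C X) k) \<in> entry_polys n" for k
    unfolding C_def
  proof (rule entry_polys_coeff_det)
    fix i j k assume "i < n" "j < n"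
    then show "(\<lambda>X. coeff [:- X $$ (i,j), if i = j then 1 else 0:] k) \<in> entry_polys n"
      using neg[of i j]
      by (cases k; cases "k - 1") (auto simp: coeff_pCons entry_polys.const)
  qed
  have coeffC': "(\<lambda>X. coeff (pderiv (C X)) k) \<in> entry_polys n" for k
    unfolding coeff_pderiv by (intro entry_polys.intros coeffC)
  let ?s = "(-1) ^ (n * (n - 1) div 2) :: real"
  \<comment> \<open>The sizes \<open>n\<close> and \<open>n - 1\<close> are fixed in advance,
    whereas \<open>resultant\<close> reads them off the degrees. On \<open>carrier_mat n n\<close>
    they agree, and division by the leading coefficient 1 disappears.\<close>
  define f where "f X = ?s * det (sylvester_mat_sub n (n - 1) (C X) (pderiv (C X)))" for X
  have "f \<in> entry_polys n"
    unfolding f_def sylvester_mat_sub_def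
  proof (intro entry_polys.mult entry_polys.const entry_polys_det)
    \<comment> \<open>The conditions on \<open>i\<close> and \<open>j\<close> do not involve
      \<open>X\<close>, so each Sylvester entry is a single coefficient or zero uniformly in
      \<open>X\<close>.\<close>
    fix i j
    show "(\<lambda>X. if i < n - 1 then if i \<le> j \<and> j - i \<le> n then coeff (C X) (n + i - j) else 0
        else if i - (n - 1) \<le> j \<and> j \<le> i then coeff (pderiv (C X)) (i - j) else 0) \<in> entry_polys n"
      by (cases "i < n - 1"; cases "i \<le> j \<and> j - i \<le> n"; cases "i - (n - 1) \<le> j \<and> j \<le> i")
        (simp_all only: coeffC coeffC' entry_polys.const if_True if_False simp_thms)
  qed
  moreover have "f X = discr X" if X: "X \<in> carrier_mat n n" for X
    using degree_monic_char_poly[OF X]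
    by (simp add: f_def C[OF X] discr_def poly_discriminant_def resultant_sub resultant_sub_def degree_pderiv)
  ultimately show ?thesis by (rule that)
qed

section \<open>Orbits of symmetric matrices\<close>

lemma change_image_eq:
  assumes S: "S \<subseteq> carrier_mat n n" and inv: "\<And>h X. h \<in> SO n \<Longrightarrow> X \<in> S \<Longrightarrow> change h X \<in> S"
    and g: "g \<in> SO n"
  shows "change g ` S = S"
proof
  show "S \<subseteq> change g ` S"
  proof
    fix X assume X: "X \<in> S"
    then have "X = change g (change (transpose_mat g) X)"
      using change_transpose_change(2)[of g n X] g S by (auto simp: SO_iff)
    then show "X \<in> change g ` S" using inv[OF SO_transpose[OF g] X] by (rule image_eqI)
  qed
qed (use inv g in auto)

lemma M_set_change: "g \<in> SO n \<Longrightarrow> X \<in> M_set n \<Longrightarrow> change g X \<in> M_set n"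
  by (auto simp: M_set_def discr_def change_Sym SO_carrier SO_iff char_poly_change SymD(1))

lemma M_set_carrier: "M_set n \<subseteq> carrier_mat n n"
  by (auto simp: M_set_def SymD)

lemma symmetric_Orbit_mat_diag:
  assumes A: "A \<in> Sym n" and n: "n > 0"
  obtains f where "mat_diag n f \<in> Orbit n A"
  using symmetric_orthogonally_diagonalizable[OF A] mat_diag_in_Orbit SymD(1)[OF A] n by metis

lemma diagonal_mat_eq_mat_diag:
  "D \<in> carrier_mat n n \<Longrightarrow> diagonal_mat D \<Longrightarrow> D = mat_diag n (\<lambda>i. D $$ (i, i))"
  by (intro eq_matI) (auto simp: mat_diag_def diagonal_mat_def)

lemma mat_diag_Sym: "mat_diag n f \<in> Sym n"
  by (auto simp: Sym_def mat_diag_def intro!: eq_matI)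

lemma scalar_mat_diag: "mat_diag n (\<lambda>_. c) = c \<cdot>\<^sub>m (1\<^sub>m n :: real mat)"
  by (intro eq_matI) (auto simp: mat_diag_def)

text \<open>A fixed point equals every member of its orbit, in particular a diagonal form and all
  its permutations. Swapping entries 0 and \<open>j\<close> then shows that the diagonal is
  constant.\<close>

lemma fixed_points_change:
  assumes n: "n > 0"
  shows "{X \<in> Sym n. \<forall>g \<in> SO n. change g X = X} = Scal n"
proof (intro equalityI subsetI)
  fix X assume "X \<in> {X \<in> Sym n. \<forall>g \<in> SO n. change g X = X}"
  then have X: "X \<in> Sym n" and fixed: "Orbit n X \<subseteq> {X}" by (auto simp: Orbit_def)
  obtain f where "mat_diag n f \<in> Orbit n X" using symmetric_Orbit_mat_diag[OF X n] .
  then have Xf: "mat_diag n f = X" using fixed by auto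
  define c where "c = f 0"
  have "f j = c" if "j < n" for j
  proof -
    have "Transposition.transpose 0 j permutes {..<n}"
      using n that by (intro permutes_swap_id) auto
    then have "mat_diag n (f \<circ> Transposition.transpose 0 j) \<in> Orbit n X"
      using permuted_mat_diag_in_Orbit[of _ n f] n Xf by simp
    then have "mat_diag n (f \<circ> Transposition.transpose 0 j) $$ (0, 0) = mat_diag n f $$ (0, 0)"
      using fixed Xf by auto
    then show ?thesis using n by (simp add: mat_diag_def c_def)
  qed
  then have "mat_diag n f = c \<cdot>\<^sub>m 1\<^sub>m n" by (intro eq_matI) (auto simp: mat_diag_def)
  then show "X \<in> Scal n" using Xf by (auto simp: Scal_def)
next
  fix X assume "X \<in> Scal n"
  then obtain c where c: "X = c \<cdot>\<^sub>m 1\<^sub>m n" by (auto simp: Scal_def)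
  then have "X \<in> Sym n" using mat_diag_Sym[of n "\<lambda>_. c"] by (simp add: scalar_mat_diag)
  then show "X \<in> {X \<in> Sym n. \<forall>g \<in> SO n. change g X = X}"
    using c by (simp add: SO_iff change_orthogonal_scalar)
qed

lemma union_of_disjoint_orbits:
  assumes S: "S \<subseteq> Sym n" and inv: "\<And>g X. g \<in> SO n \<Longrightarrow> X \<in> S \<Longrightarrow> change g X \<in> S"
  shows "\<exists>F. F \<subseteq> Orbits n \<and> pairwise disjnt F \<and> S = \<Union>F"
proof (intro exI conjI)
  have c: "X \<in> carrier_mat n n" if "X \<in> S" for X using S that SymD(1) by auto
  show "Orbit n ` S \<subseteq> Orbits n" using S by (auto simp: Orbits_def)
  show "pairwise disjnt (Orbit n ` S)"
  proof (rule pairwiseI)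
    fix P Q assume PQ: "P \<in> Orbit n ` S" "Q \<in> Orbit n ` S" "P \<noteq> Q"
    show "disjnt P Q"
    proof (rule ccontr)
      assume "\<not> disjnt P Q"
      then obtain Z where "Z \<in> P" "Z \<in> Q" by (auto simp: disjnt_def)
      then have "Orbit n Z = P" "Orbit n Z = Q" using PQ Orbit_eq c by blast+
      then show False using PQ by simp
    qed
  qed
  show "S = \<Union>(Orbit n ` S)"
    using Orbit_self c inv by (auto simp: Orbit_def)
qed

text \<open>Whether a diagonal matrix lies in an orbit depends only on the spectrum, so a diagonal
  form of \<open>A\<close> serves \<open>B\<close> as well and joins the two orbits.\<close>

lemma same_orbit_iff_spectrum:
  assumes A: "A \<in> Sym n" and B: "B \<in> Sym n" and n: "n > 0"
  shows "(\<exists>Q \<in> Orbits n. A \<in> Q \<and> B \<in> Q) \<longleftrightarrow> spectrum_mset A = spectrum_mset B"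
proof
  assume "\<exists>Q \<in> Orbits n. A \<in> Q \<and> B \<in> Q"
  then obtain X where "X \<in> Sym n" "A \<in> Orbit n X" "B \<in> Orbit n X" by (auto simp: Orbits_def)
  then show "spectrum_mset A = spectrum_mset B" using spectrum_mset_Orbit SymD(1) by metis
next
  assume eq: "spectrum_mset A = spectrum_mset B"
  obtain f where f: "mat_diag n f \<in> Orbit n A" using symmetric_Orbit_mat_diag[OF A n] .
  then have "mat_diag n f \<in> Orbit n B"
    using eq by (simp add: mat_diag_in_Orbit_iff[OF A n] mat_diag_in_Orbit_iff[OF B n])
  then have "Orbit n A = Orbit n B" using f Orbit_eq SymD(1)[OF A] SymD(1)[OF B] by metis
  then show "\<exists>Q \<in> Orbits n. A \<in> Q \<and> B \<in> Q"
    using Orbit_self SymD(1)[OF A] SymD(1)[OF B] A by (auto simp: Orbits_def)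
qed

lemma ex1_diagonal_ordered_in_Orbit:
  assumes A: "A \<in> Sym n" and n: "n > 0"
  shows "\<exists>!D. D \<in> Orbit n A \<and> diagonal_ordered n D"
proof -
  \<comment> \<open>The eigenvalues in increasing order are the only possible ordered diagonal,
    since a sorted list is determined by its multiset.\<close>
  define xs where "xs = sorted_list_of_multiset (spectrum_mset A)"
  obtain f where "mat_diag n f \<in> Orbit n A" using symmetric_Orbit_mat_diag[OF A n] .
  then have "spectrum_mset A = mset (map f [0..<n])" by (simp only: mat_diag_in_Orbit_iff[OF A n])
  then have len: "length xs = n"
    unfolding xs_def by (metis diff_zero length_map length_upt mset_sorted_list_of_multiset size_mset)
  have map_xs: "map (\<lambda>i. xs ! i) [0..<n] = xs" using len by (metis map_nth)
  show ?thesis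
  proof (rule ex1I[of _ "mat_diag n (\<lambda>i. xs ! i)"])
    have "mset xs = spectrum_mset A" by (simp add: xs_def)
    then have "mat_diag n (\<lambda>i. xs ! i) \<in> Orbit n A"
      by (simp only: mat_diag_in_Orbit_iff[OF A n] map_xs)
    moreover have "sorted xs" by (simp add: xs_def)
    then have "diagonal_ordered n (mat_diag n (\<lambda>i. xs ! i))"
      using len by (auto simp: diagonal_ordered_def diagonal_mat_def mat_diag_def sorted_iff_nth_mono)
    ultimately show "mat_diag n (\<lambda>i. xs ! i) \<in> Orbit n A \<and> diagonal_ordered n (mat_diag n (\<lambda>i. xs ! i))"
      by simp
  next
    fix D assume D: "D \<in> Orbit n A \<and> diagonal_ordered n D"
    define h where "h i = D $$ (i, i)" for i
    have Dh: "D = mat_diag n h"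
      unfolding h_def using D by (intro diagonal_mat_eq_mat_diag) (auto simp: diagonal_ordered_def)
    then have "spectrum_mset A = mset (map h [0..<n])"
      using D by (simp only: mat_diag_in_Orbit_iff[OF A n])
    moreover have "sorted (map h [0..<n])"
      using D by (auto simp: sorted_iff_nth_mono diagonal_ordered_def h_def)
    ultimately have "map h [0..<n] = xs"
      unfolding xs_def by (metis sorted_list_of_multiset_mset sorted_sort_id)
    then have "h i = xs ! i" if "i < n" for i using that by (metis add_0 diff_zero length_upt nth_map nth_upt)
    then show "D = mat_diag n (\<lambda>i. xs ! i)" unfolding Dh by (intro eq_matI) (auto simp: mat_diag_def)
  qed
qed

section \<open>Orbits under homotheties and scalar shifts\<close>

lemma Orbit_smult:
  assumes "A \<in> carrier_mat n n"
  shows "Orbit n (t \<cdot>\<^sub>m A) = (\<lambda>X. t \<cdot>\<^sub>m X) ` Orbit n A"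
  using assms by (auto simp: Orbit_def image_image change_smult[OF SO_carrier] intro!: image_cong)

text \<open>Changes are additive and orthogonal ones fix scalar matrices, so they commute with
  scalar shifts.\<close>

lemma Orbit_scalar_shift:
  assumes "A \<in> carrier_mat n n"
  shows "Orbit n (scalar_shift n c A) = scalar_shift n c ` Orbit n A"
proof -
  have "change g (scalar_shift n c A) = scalar_shift n c (change g A)" if "g \<in> SO n" for g
    using that assms SO_carrier[OF that]
    by (auto simp: scalar_shift_def change_add[of _ n] SO_iff change_orthogonal_scalar)
  then show ?thesis by (auto simp: Orbit_def image_image intro!: image_cong)
qed

lemma eigenvalue_iff_spectrum_mset:
  assumes "A \<in> carrier_mat n n"
  shows "eigenvalue A k \<longleftrightarrow> k \<in># spectrum_mset A"
proof -
  have "char_poly A \<noteq> 0" using degree_monic_char_poly[OF assms] by auto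
  then show ?thesis by (simp add: eigenvalue_root_char_poly[OF assms] spectrum_mset_def)
qed

text \<open>Two distinct values among three eigenvalues leave one double and one simple; the simple
  one \<open>b\<close> is placed last.\<close>

lemma MH_set_3_normal_form:
  assumes A: "A \<in> MH_set 3"
  obtains a b where "a \<noteq> b" "mat_diag 3 (\<lambda>i. if i = 2 then b else a) \<in> Orbit 3 A"
proof -
  have S: "A \<in> Sym 3" and card: "card {k. eigenvalue A k} = 2" using A by (auto simp: MH_set_def)
  have upt: "[0..<3] = [0, 1, 2 :: nat]" by (simp add: upt_rec)
  obtain f where "mat_diag 3 f \<in> Orbit 3 A" using symmetric_Orbit_mat_diag[OF S] by auto
  then have spec: "spectrum_mset A = {#f 0, f 1, f 2#}"
    by (simp add: mat_diag_in_Orbit_iff[OF S] upt)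
  then have "{k. eigenvalue A k} = {f 0, f 1, f 2}"
    by (auto simp: eigenvalue_iff_spectrum_mset[OF SymD(1)[OF S]])
  then have card3: "card {f 0, f 1, f 2} = 2" using card by simp
  have "\<exists>a b. a \<noteq> b \<and> {#f 0, f 1, f 2#} = {#a, a, b#}"
  proof (cases "f 0 = f 1")
    case True
    then show ?thesis using card3 by (intro exI[of _ "f 0"] exI[of _ "f 2"]) auto
  next
    case False
    then have "f 2 = f 0 \<or> f 2 = f 1" using card3 by (auto simp: card_insert_if split: if_splits)
    then show ?thesis
    proof
      assume "f 2 = f 0"
      then show ?thesis using False by (intro exI[of _ "f 0"] exI[of _ "f 1"]) auto
    next
      assume "f 2 = f 1"
      then show ?thesis using False by (intro exI[of _ "f 1"] exI[of _ "f 0"]) auto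
    qed
  qed
  then obtain a b where ab: "a \<noteq> b" "spectrum_mset A = {#a, a, b#}" using spec by auto
  then have "mat_diag 3 (\<lambda>i. if i = 2 then b else a) \<in> Orbit 3 A"
    by (simp add: mat_diag_in_Orbit_iff[OF S] upt)
  with ab(1) show ?thesis by (rule that)
qed

lemma MH_set_3_orbits:
  assumes A: "A \<in> MH_set 3" and B: "B \<in> MH_set 3"
  shows "\<exists>c b. b \<noteq> 0 \<and> Orbit 3 B = (\<lambda>X. homothety b (scalar_shift 3 c X)) ` Orbit 3 A"
proof -
  obtain a b where ab: "a \<noteq> b" and f: "mat_diag 3 (\<lambda>i. if i = 2 then b else a) \<in> Orbit 3 A"
    using MH_set_3_normal_form[OF A] .
  obtain a' b' where ab': "a' \<noteq> b'" and f': "mat_diag 3 (\<lambda>i. if i = 2 then b' else a') \<in> Orbit 3 B"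
    using MH_set_3_normal_form[OF B] .
  let ?D = "mat_diag 3 (\<lambda>i. if i = 2 then b else a)" and ?D' = "mat_diag 3 (\<lambda>i. if i = 2 then b' else a')"
  have oA: "Orbit 3 A = Orbit 3 ?D" using Orbit_eq[OF _ f] A SymD(1) by (auto simp: MH_set_def)
  have oB: "Orbit 3 B = Orbit 3 ?D'" using Orbit_eq[OF _ f'] B SymD(1) by (auto simp: MH_set_def)
  \<comment> \<open>\<open>t\<close> and \<open>c\<close> solve \<open>t * (a + c) = a'\<close> and
    \<open>t * (b + c) = b'\<close>: the shift is applied before the homothety. The factor is
    nonzero because \<open>a'\<close> and \<open>b'\<close> differ.\<close>
  define t where "t = (b' - a') / (b - a)"
  define c where "c = a' / t - a"
  have t: "t \<noteq> 0" using ab ab' by (simp add: t_def)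
  have "t * (b + c) = t * (a + c) + t * (b - a)" by (simp add: algebra_simps)
  also have "t * (b - a) = b' - a'" using ab by (simp add: t_def)
  finally have tb: "t * (b + c) = b'" and ta: "t * (a + c) = a'" using t by (simp_all add: c_def)
  have "?D' = t \<cdot>\<^sub>m scalar_shift 3 c ?D"
    using ta tb by (intro eq_matI) (auto simp: mat_diag_def scalar_shift_def)
  moreover have "scalar_shift 3 c ?D \<in> carrier_mat 3 3" by (simp add: scalar_shift_def)
  ultimately have "Orbit 3 B = (\<lambda>X. homothety t (scalar_shift 3 c X)) ` Orbit 3 A"
    unfolding oA oB by (simp add: Orbit_smult Orbit_scalar_shift image_image homothety_def)
  then show ?thesis using t by blast
qed

section \<open>The surface of matrices with a multiple eigenvalue\<close>

text \<open>The characteristic polynomial of a diagonal matrix splits, with the entries as its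
  roots, so the root criterion for the discriminant applies.\<close>

lemma discr_mat_diag:
  "discr (mat_diag n f) = 0 \<longleftrightarrow> \<not> inj_on f {..<n}"
proof -
  let ?p = "char_poly (mat_diag n f)"
  have deg: "degree ?p = n" and p0: "?p \<noteq> 0"
    using degree_monic_char_poly[OF mat_diag_dim[of n f]] by auto
  have roots: "proots ?p = mset (map f [0..<n])"
    using spectrum_mset_mat_diag by (simp only: spectrum_mset_def)
  have "discr (mat_diag n f) = 0 \<longleftrightarrow> \<not> rsquarefree ?p"
    unfolding discr_def using p0 by (rule poly_discriminant_eq_0_iff) (simp add: roots deg)
  also have "rsquarefree ?p \<longleftrightarrow> (\<forall>a. count (proots ?p) a \<le> 1)"
    using p0 by (auto simp: rsquarefree_def le_Suc_eq)
  also have "\<dots> \<longleftrightarrow> distinct (map f [0..<n])"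
    unfolding roots by (metis distinct_count_atmost_1 One_nat_def count_mset_0_iff le_Suc_eq le_zero_eq
        less_one linorder_not_le count_mset_gt_0 nat_le_linear zero_less_one)
  also have "\<dots> \<longleftrightarrow> inj_on f {..<n}" by (simp add: distinct_map lessThan_atLeast0)
  finally show ?thesis .
qed

section \<open>Trace, scalar shifts and the surface property\<close>

lemma mat_trace_mult_commute:
  assumes A: "A \<in> carrier_mat n n" and B: "B \<in> carrier_mat n n"
  shows "mat_trace (A * B) = mat_trace (B * A)"
proof -
  have "mat_trace (A * B) = (\<Sum>i<n. \<Sum>j<n. A $$ (i,j) * B $$ (j,i))"
    using A B by (simp add: mat_trace_def scalar_prod_def lessThan_atLeast0)
  also have "\<dots> = (\<Sum>j<n. \<Sum>i<n. B $$ (j,i) * A $$ (i,j))"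
    by (subst sum.swap) (simp add: mult.commute)
  also have "\<dots> = mat_trace (B * A)"
    using A B by (simp add: mat_trace_def scalar_prod_def lessThan_atLeast0)
  finally show ?thesis .
qed

lemma mat_trace_change:
  assumes g: "g \<in> orthogonal_matrices n" and X: "X \<in> carrier_mat n n"
  shows "mat_trace (change g X) = mat_trace X"
proof -
  note gm = orthogonal_matricesD[OF g]
  have "mat_trace (g * (X * transpose_mat g)) = mat_trace ((X * transpose_mat g) * g)"
    using gm X by (intro mat_trace_mult_commute) auto
  then show ?thesis using gm X by (simp add: change_def)
qed

lemma mat_trace_mat_diag: "mat_trace (mat_diag n f) = (\<Sum>i<n. f i)"
  by (simp add: mat_trace_def mat_diag_def)

lemma mat_trace_scalar_shift:
  "X \<in> carrier_mat n n \<Longrightarrow> mat_trace (scalar_shift n c X) = mat_trace X + of_nat n * c"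
  by (simp add: mat_trace_def scalar_shift_def sum.distrib)

lemma scalar_shift_Sym: "X \<in> Sym n \<Longrightarrow> scalar_shift n c X \<in> Sym n"
  by (auto simp: Sym_def scalar_shift_def transpose_add[of _ n n] intro!: eq_matI)

lemma M_set_scalar_shift: "X \<in> M_set n \<Longrightarrow> scalar_shift n c X \<in> M_set n"
  by (simp add: M_set_def scalar_shift_Sym discr_scalar_shift SymD(1))

lemma scalar_shift_scalar_shift:
  "X \<in> carrier_mat n n \<Longrightarrow> scalar_shift n c (scalar_shift n d X) = scalar_shift n (c + d) X"
  by (intro eq_matI) (auto simp: scalar_shift_def)

lemma scalar_shift_0: "X \<in> carrier_mat n n \<Longrightarrow> scalar_shift n 0 X = X"
  by (intro eq_matI) (auto simp: scalar_shift_def)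

lemma scalar_shift_M_set_eq: "scalar_shift n c ` M_set n = M_set n"
proof
  show "M_set n \<subseteq> scalar_shift n c ` M_set n"
  proof
    fix X assume X: "X \<in> M_set n"
    then have "X = scalar_shift n c (scalar_shift n (- c) X)"
      using subsetD[OF M_set_carrier] by (simp add: scalar_shift_scalar_shift scalar_shift_0)
    then show "X \<in> scalar_shift n c ` M_set n" using M_set_scalar_shift[OF X] by (rule image_eqI)
  qed
qed (auto simp: M_set_scalar_shift)

text \<open>The scalar matrix shows that the zero set is nonempty, since \<open>n > 1\<close> gives
  a repeated entry; the diagonal matrix with distinct entries shows that the equation is not an
  identity on \<open>V\<close>.\<close>

lemma is_surface_in_zero_discr:
  assumes V: "V \<subseteq> carrier_mat n n" and n: "n > 1"
    and zero: "mat_diag n (\<lambda>_. c) \<in> V" and nonzero: "mat_diag n f \<in> V" "inj_on f {..<n}"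
  shows "is_surface_in n V {X \<in> V. discr X = 0}"
proof -
  obtain d where d: "d \<in> entry_polys n" "\<And>X. X \<in> carrier_mat n n \<Longrightarrow> d X = discr X"
    using discr_entry_poly[of n] n by auto
  have dV: "d X = discr X" if "X \<in> V" for X using d V that by auto
  have "\<not> inj_on (\<lambda>_. c) {..<n}" using n inj_onD[of "\<lambda>_. c" "{..<n}" 0 1] by auto
  then have "mat_diag n (\<lambda>_. c) \<in> {X \<in> V. discr X = 0}" using zero discr_mat_diag by auto
  moreover have "d (mat_diag n f) \<noteq> 0" using nonzero dV discr_mat_diag by auto
  moreover have "{X \<in> V. discr X = 0} = {X \<in> V. d X = 0}" using dV by auto
  ultimately show ?thesis unfolding is_surface_in_def using d(1) nonzero(1) by blast
qed

lemma is_surface_in_M_set: "n > 1 \<Longrightarrow> is_surface_in n (Sym n) (M_set n)"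
  unfolding M_set_def
  by (rule is_surface_in_zero_discr[where c = 0 and f = of_nat])
    (auto simp: mat_diag_Sym SymD inj_on_def)

lemma is_surface_in_M_slice:
  assumes n: "n > 1"
  shows "is_surface_in n (trace_hyperplane n s) (M_slice n s)"
proof -
  have eq: "M_slice n s = {X \<in> trace_hyperplane n s. discr X = 0}"
    by (auto simp: M_slice_def M_set_def trace_hyperplane_def)
  \<comment> \<open>\<open>k\<close> shifts the distinct entries 0, ..., n - 1 so that the trace
    becomes \<open>s\<close>; the scalar witness has all entries \<open>s / n\<close>.\<close>
  define k where "k = (s - (\<Sum>i<n. real i)) / n"
  have "(\<Sum>i<n. real i + k) = s" using n by (simp add: sum.distrib k_def)
  moreover have "(\<Sum>i<n. s / n) = s" using n by simp
  ultimately show ?thesis unfolding eq using n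
    by (intro is_surface_in_zero_discr[where c = "s / n" and f = "\<lambda>i. real i + k"])
      (auto simp: trace_hyperplane_def mat_diag_Sym SymD inj_on_def mat_trace_mat_diag simp del: sum_constant)
qed

lemma M_slice_change: "g \<in> SO n \<Longrightarrow> X \<in> M_slice n s \<Longrightarrow> change g X \<in> M_slice n s"
  using M_set_change[of g n X] mat_trace_change[of g n X] SO_subset_orthogonal[of n] change_Sym[of g n X]
  by (auto simp: M_slice_def trace_hyperplane_def SymD SO_carrier)

section \<open>Hyperplanes of constant trace and the cylinder\<close>

lemma mat_inner_scalar:
  assumes "X \<in> carrier_mat n n"
  shows "mat_inner n X (c \<cdot>\<^sub>m 1\<^sub>m n) = c * mat_trace X" "mat_inner n (c \<cdot>\<^sub>m 1\<^sub>m n) X = c * mat_trace X"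
proof -
  have "mat_inner n X (c \<cdot>\<^sub>m 1\<^sub>m n) = (\<Sum>i<n. \<Sum>j<n. if j = i then c * X $$ (i,i) else 0)"
    unfolding mat_inner_def by (intro sum.cong refl) auto
  then show 1: "mat_inner n X (c \<cdot>\<^sub>m 1\<^sub>m n) = c * mat_trace X"
    using assms by (simp add: mat_trace_def sum_distrib_left)
  then show "mat_inner n (c \<cdot>\<^sub>m 1\<^sub>m n) X = c * mat_trace X"
    by (simp add: mat_inner_def mult.commute)
qed

lemma is_hyperplane_trace_hyperplane:
  assumes n: "n > 0"
  shows "is_hyperplane n (trace_hyperplane n s)"
proof -
  \<comment> \<open>The identity matrix is the normal; it is written as a multiple by 1 to match the
    lemmas on scalar matrices.\<close>
  have "trace_hyperplane n s = {X \<in> Sym n. mat_inner n (1 \<cdot>\<^sub>m 1\<^sub>m n) X = s}"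
    by (auto simp: trace_hyperplane_def mat_inner_scalar SymD)
  moreover have "1 \<cdot>\<^sub>m 1\<^sub>m n \<in> Sym n" using mat_diag_Sym[of n "\<lambda>_. 1"] by (simp only: scalar_mat_diag)
  moreover have "(1 \<cdot>\<^sub>m 1\<^sub>m n :: real mat) $$ (0,0) \<noteq> 0\<^sub>m n n $$ (0,0)" using n by simp
  then have "1 \<cdot>\<^sub>m 1\<^sub>m n \<noteq> (0\<^sub>m n n :: real mat)" by metis
  ultimately show ?thesis unfolding is_hyperplane_def by blast
qed

text \<open>Pairing with a scalar matrix is a multiple of the trace, and the difference of two
  matrices of equal trace has trace zero.\<close>

lemma orthogonal_to_Scal_trace_hyperplane: "orthogonal_to_Scal n (trace_hyperplane n s)"
proof -
  have "mat_trace (X - Y) = mat_trace X - mat_trace Y"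
    if "X \<in> carrier_mat n n" "Y \<in> carrier_mat n n" for X Y
    using that by (simp add: mat_trace_def sum_subtractf)
  then show ?thesis
    by (auto simp: orthogonal_to_Scal_def Scal_def trace_hyperplane_def mat_inner_scalar SymD minus_carrier_mat)
qed

lemma straight_cylinder_over_M_slice:
  assumes n: "n > 0"
  shows "straight_cylinder_over n (M_set n) (M_slice n s)"
  unfolding straight_cylinder_over_def
proof (intro conjI exI[of _ "trace_hyperplane n s"])
  show "is_hyperplane n (trace_hyperplane n s)" using n by (rule is_hyperplane_trace_hyperplane)
  show "orthogonal_to_Scal n (trace_hyperplane n s)" by (rule orthogonal_to_Scal_trace_hyperplane)
  show "M_slice n s \<subseteq> trace_hyperplane n s" by (auto simp: M_slice_def)
  have "\<exists>Y c. X = Y + c \<cdot>\<^sub>m 1\<^sub>m n \<and> Y \<in> M_slice n s" if X: "X \<in> M_set n" for X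
  proof -
    have Xc: "X \<in> carrier_mat n n" using X M_set_carrier by auto
    \<comment> \<open>Shifting by \<open>- c\<close> lowers the trace by \<open>n * c\<close>, which
      brings it to \<open>s\<close>.\<close>
    define c where "c = (mat_trace X - s) / n"
    have "scalar_shift n (- c) X \<in> M_slice n s"
      using M_set_scalar_shift[OF X, of "- c"] n Xc
      by (auto simp: M_slice_def trace_hyperplane_def M_set_def mat_trace_scalar_shift c_def)
    moreover have "X = scalar_shift n c (scalar_shift n (- c) X)"
      using Xc by (simp add: scalar_shift_scalar_shift scalar_shift_0)
    ultimately show ?thesis unfolding scalar_shift_def[of n c] by blast
  qed
  moreover have "X + c \<cdot>\<^sub>m 1\<^sub>m n \<in> M_set n" if "X \<in> M_slice n s" for X c
    using M_set_scalar_shift[of X n c] that by (simp add: M_slice_def scalar_shift_def)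
  ultimately show "M_set n = {X + c \<cdot>\<^sub>m 1\<^sub>m n | X c. X \<in> M_slice n s}" by blast
qed

theorem mainTheorem6:
  fixes n :: nat
  assumes "n > 2"
  shows
    "(\<forall>g \<in> SO n. change g ` M_set n = M_set n)
   \<and> {X \<in> Sym n. \<forall>g \<in> SO n. change g X = X} = Scal n
   \<and> (\<exists>F. F \<subseteq> Orbits n \<and> pairwise disjnt F \<and> M_set n = \<Union>F)
   \<and> ((\<forall>D \<in> MD_set n. \<exists>g \<in> SO n. diagonal_ordered n (change g D))
      \<and> (\<forall>D \<in> MD_set n. \<forall>p. p permutes {..<n} \<longrightarrow>
           (\<exists>g \<in> SO n. change g D = permute_diagonal n p D)))
   \<and> (\<forall>A \<in> M_set n. \<forall>B \<in> M_set n.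
        (\<exists>Q \<in> Orbits n. A \<in> Q \<and> B \<in> Q) \<longleftrightarrow> spectrum_mset A = spectrum_mset B)
   \<and> (\<forall>A \<in> M_set n. \<exists>!D. D \<in> Orbit n A \<and> diagonal_ordered n D)
   \<and> (\<forall>t::real. \<forall>A \<in> Sym n. Orbit n (t \<cdot>\<^sub>m A) = (\<lambda>X. t \<cdot>\<^sub>m X) ` Orbit n A)
   \<and> (n = 3 \<longrightarrow> (\<forall>A \<in> MH_set n. \<forall>B \<in> MH_set n. \<exists>c b. b \<noteq> 0 \<and>
        Orbit n B = (\<lambda>X. homothety b (scalar_shift n c X)) ` Orbit n A))
   \<and> ((\<forall>A \<in> carrier_mat n n. \<forall>c. discr (scalar_shift n c A) = discr A)
      \<and> is_surface_in n (Sym n) (M_set n)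
      \<and> (\<forall>c. scalar_shift n c ` M_set n = M_set n))
   \<and> ((\<forall>s. is_surface_in n (trace_hyperplane n s) (M_slice n s)
           \<and> (\<forall>g \<in> SO n. change g ` M_slice n s = M_slice n s))
      \<and> straight_cylinder_over n (M_set n) (M_slice n 0))"
proof (intro conjI allI ballI impI)
  have n: "n > 0" "n > 1" using assms by auto
  have MD: "D \<in> Sym n" "D = mat_diag n (\<lambda>i. D $$ (i, i))" if "D \<in> MD_set n" for D
    using that diagonal_mat_eq_mat_diag[of D n] by (auto simp: MD_set_def M_set_def SymD)
  show "change g ` M_set n = M_set n" if "g \<in> SO n" for g
    using change_image_eq[OF M_set_carrier M_set_change that] .
  show "{X \<in> Sym n. \<forall>g \<in> SO n. change g X = X} = Scal n"
    using n(1) by (rule fixed_points_change)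
  show "\<exists>F. F \<subseteq> Orbits n \<and> pairwise disjnt F \<and> M_set n = \<Union>F"
    by (rule union_of_disjoint_orbits) (auto simp: M_set_change, simp add: M_set_def)
  \<comment> \<open>Only existence is needed here: the ordered member of the orbit of
    \<open>D\<close> is by definition of the form \<open>change g D\<close>.\<close>
  show "\<exists>g \<in> SO n. diagonal_ordered n (change g D)" if "D \<in> MD_set n" for D
    using ex1_diagonal_ordered_in_Orbit[OF MD(1)[OF that] n(1)] by (auto simp: Orbit_def)
  show "\<exists>g \<in> SO n. change g D = permute_diagonal n p D"
    if D: "D \<in> MD_set n" and p: "p permutes {..<n}" for D p
  proof -
    have "permute_diagonal n p D = mat_diag n ((\<lambda>i. D $$ (i, i)) \<circ> p)"
      by (intro eq_matI) (auto simp: permute_diagonal_def mat_diag_def)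
    then have "permute_diagonal n p D \<in> Orbit n D"
      using permuted_mat_diag_in_Orbit[OF p n(1), of "\<lambda>i. D $$ (i, i)"] MD(2)[OF D] by simp
    then show ?thesis by (auto simp: Orbit_def)
  qed
  show "(\<exists>Q \<in> Orbits n. A \<in> Q \<and> B \<in> Q) \<longleftrightarrow> spectrum_mset A = spectrum_mset B"
    if "A \<in> M_set n" "B \<in> M_set n" for A B
    using that n(1) by (intro same_orbit_iff_spectrum) (auto simp: M_set_def)
  show "\<exists>!D. D \<in> Orbit n A \<and> diagonal_ordered n D" if "A \<in> M_set n" for A
    using that n(1) by (intro ex1_diagonal_ordered_in_Orbit) (auto simp: M_set_def)
  show "Orbit n (t \<cdot>\<^sub>m A) = (\<lambda>X. t \<cdot>\<^sub>m X) ` Orbit n A" if "A \<in> Sym n" for t A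
    using that by (intro Orbit_smult SymD(1))
  show "\<exists>c b. b \<noteq> 0 \<and> Orbit n B = (\<lambda>X. homothety b (scalar_shift n c X)) ` Orbit n A"
    if "n = 3" "A \<in> MH_set n" "B \<in> MH_set n" for A B
    using that MH_set_3_orbits by simp
  show "discr (scalar_shift n c A) = discr A" if "A \<in> carrier_mat n n" for A c
    using that by (rule discr_scalar_shift)
  show "is_surface_in n (Sym n) (M_set n)" using n(2) by (rule is_surface_in_M_set)
  show "scalar_shift n c ` M_set n = M_set n" for c by (rule scalar_shift_M_set_eq)
  show "is_surface_in n (trace_hyperplane n s) (M_slice n s)" for s
    using n(2) by (rule is_surface_in_M_slice)
  show "change g ` M_slice n s = M_slice n s" if "g \<in> SO n" for s g
  proof -
    have "M_slice n s \<subseteq> carrier_mat n n" using M_set_carrier by (auto simp: M_slice_def)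
    then show ?thesis using M_slice_change that by (rule change_image_eq)
  qed
  show "straight_cylinder_over n (M_set n) (M_slice n 0)"
    using n(1) by (rule straight_cylinder_over_M_slice)
qed

end
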